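(* Let $n\ge 1$, let $m_i, C_i, K_i^{\omega}, K_i^{\text{droop}}, K_i^{V}$ ($i=1,\dots,n$) be arbitrary positive real numbers, let $V^{\text{nom}}>0$, let $P^m\in\mathbb{R}^n$ be a constant vector, and let $\mathcal{L}_R$ be the weighted Laplacian matrix of a connected undirected graph on the vertices $1,\dots,n$ with positive edge weights $1/R_{ij}$. Put $M=\operatorname{diag}(m_1^{-1},\dots,m_n^{-1})$, $E=\operatorname{diag}(C_1^{-1},\dots,C_n^{-1})$, $K^{\omega}=\operatorname{diag}(K_1^{\omega},\dots,K_n^{\omega})$, $K^{\text{droop}}=\operatorname{diag}(K_1^{\text{droop}},\dots,K_n^{\text{droop}})$, $K^{V}=\operatorname{diag}(K_1^{V},\dots,K_n^{V})$, and $$A=\begin{bmatrix} -M(K^{\omega}+K^{\text{droop}}) & MK^{V}\\ \frac{1}{V^{\text{nom}}}EK^{\omega} & -E\left(\mathcal{L}_R+\frac{K^{V}}{V^{\text{nom}}}\right)\end{bmatrix}\in\mathbb{R}^{2n\times 2n}.$$ Assume that $A$ has full rank, so that the linear system $$\begin{bmatrix}\dot{\hat\omega}\\ \dot{\hat V}\end{bmatrix}=A\begin{bmatrix}\hat\omega\\ \hat V\end{bmatrix}+\begin{bmatrix}MP^m\\ 0_{n\times 1}\end{bmatrix},\qquad \hat\omega(t),\hat V(t)\in\mathbb{R}^n,$$ has a unique equilibrium. Then this equilibrium is globally asymptotically stable.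
   Context: The system describes $n$ AC areas (one aggregate generator each) connected through a multi-terminal HVDC (MTDC) grid under decentralized proportional control. Here $\hat\omega=\omega-\omega^{\text{ref}}1_{n\times 1}$ and $\hat V=V-V^{\text{ref}}$ are the deviations of the AC frequencies and the DC converter voltages from their reference values, $m_i$ is the inertia of generator $i$, $C_i$ is the capacitance of converter $i$, $R_{ij}=R_{ji}>0$ is the resistance of the HVDC line between converters $i$ and $j$, $P^m$ is the vector of (constant) uncontrolled deviations from the nominal generated powers, and $K_i^{\omega}, K_i^{V}, K_i^{\text{droop}}$ are controller gains. The weighted Laplacian of a graph with vertex-edge incidence matrix $\mathcal{B}$ and diagonal edge-weight matrix $W$ is $\mathcal{B}W\mathcal{B}^T$. The symbol $0_{n\times 1}$ denotes the zero vector in $\mathbb{R}^n$. *)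

theory Defs
  imports "HOL-Analysis.Analysis"
begin

definition diag_matrix :: "real^'n \<Rightarrow> real^'n^'n" where
  "diag_matrix d = (\<chi> i j. if i = j then d $ i else 0)"

definition block_vector :: "real^'m \<Rightarrow> real^'n \<Rightarrow> real^('m + 'n)" where
  "block_vector u v = (\<chi> i. case i of Inl k \<Rightarrow> u $ k | Inr k \<Rightarrow> v $ k)"

definition block_matrix ::
  "real^'m^'m \<Rightarrow> real^'n^'m \<Rightarrow> real^'m^'n \<Rightarrow> real^'n^'n \<Rightarrow> real^('m + 'n)^('m + 'n)" where
  "block_matrix P Q S T = (\<chi> i j.
     case i of
       Inl k \<Rightarrow> (case j of Inl l \<Rightarrow> P $ k $ l | Inr l \<Rightarrow> Q $ k $ l)
     | Inr k \<Rightarrow> (case j of Inl l \<Rightarrow> S $ k $ l | Inr l \<Rightarrow> T $ k $ l))"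

text \<open>
  A simple undirected graph on the vertex type is given by its symmetric, irreflexive
  adjacency relation.
\<close>

definition connected_graph :: "('v \<times> 'v) set \<Rightarrow> bool" where
  "connected_graph G \<longleftrightarrow> sym G \<and> irrefl G \<and> (\<forall>u v. (u, v) \<in> G\<^sup>*)"

text \<open>An orientation keeps exactly one of the two ordered pairs of every undirected edge.\<close>

definition orientation_of :: "('v \<times> 'v) set \<Rightarrow> ('v \<times> 'v) set \<Rightarrow> bool" where
  "orientation_of D G \<longleftrightarrow> D \<union> D\<inverse> = G \<and> D \<inter> D\<inverse> = {}"

text \<open>
  Columns are indexed by all ordered pairs of vertices, so that graphs without edges need no
  special treatment. Columns of pairs that are not oriented edges vanish and hence
  contribute nothing to the Laplacian, whatever weight they carry.
\<close>

definition incidence_matrix :: "('v \<times> 'v) set \<Rightarrow> real^('v \<times> 'v)^'v" where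
  "incidence_matrix D = (\<chi> i e.
     if e \<in> D then (if i = fst e then 1 else if i = snd e then - 1 else 0) else 0)"

definition weighted_laplacian :: "('v \<times> 'v) set \<Rightarrow> ('v \<Rightarrow> 'v \<Rightarrow> real) \<Rightarrow> real^'v^'v" where
  "weighted_laplacian D w =
     incidence_matrix D ** diag_matrix (\<chi> e. w (fst e) (snd e)) ** transpose (incidence_matrix D)"

definition mtdc_matrix ::
  "real^'n \<Rightarrow> real^'n \<Rightarrow> real^'n \<Rightarrow> real^'n \<Rightarrow> real^'n \<Rightarrow> real \<Rightarrow> real^'n^'n \<Rightarrow> real^('n + 'n)^('n + 'n)"
where
  "mtdc_matrix m C k\<omega> kdroop kV Vnom L =
    (let M = diag_matrix (\<chi> i. inverse (m $ i));
         E = diag_matrix (\<chi> i. inverse (C $ i));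
         K\<omega> = diag_matrix k\<omega>;
         Kdroop = diag_matrix kdroop;
         KV = diag_matrix kV
     in block_matrix
          (- (M ** (K\<omega> + Kdroop)))      (M ** KV)
          ((1 / Vnom) *\<^sub>R (E ** K\<omega>))    (- (E ** (L + (1 / Vnom) *\<^sub>R KV))))"

definition mtdc_input :: "real^'n \<Rightarrow> real^'n \<Rightarrow> real^('n + 'n)" where
  "mtdc_input m Pm = block_vector (diag_matrix (\<chi> i. inverse (m $ i)) *v Pm) 0"

definition equilibrium :: "('a::real_normed_vector \<Rightarrow> 'a) \<Rightarrow> 'a \<Rightarrow> bool" where
  "equilibrium f p \<longleftrightarrow> f p = 0"

definition forward_solution :: "('a::real_normed_vector \<Rightarrow> 'a) \<Rightarrow> (real \<Rightarrow> 'a) \<Rightarrow> bool" where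
  "forward_solution f x \<longleftrightarrow>
     (\<forall>t\<ge>0. (x has_vector_derivative f (x t)) (at t within {0..}))"

definition lyapunov_stable :: "('a::real_normed_vector \<Rightarrow> 'a) \<Rightarrow> 'a \<Rightarrow> bool" where
  "lyapunov_stable f p \<longleftrightarrow>
     (\<forall>\<epsilon>>0. \<exists>\<delta>>0. \<forall>x. forward_solution f x \<and> norm (x 0 - p) < \<delta> \<longrightarrow>
        (\<forall>t\<ge>0. norm (x t - p) < \<epsilon>))"

definition globally_attractive :: "('a::real_normed_vector \<Rightarrow> 'a) \<Rightarrow> 'a \<Rightarrow> bool" where
  "globally_attractive f p \<longleftrightarrow>
     (\<forall>x. forward_solution f x \<longrightarrow> (x \<longlongrightarrow> p) at_top)"

text \<open>
  Existence of a solution on the whole half-line from every initial state is part of the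
  notion, so that the two quantifications over solutions cannot hold vacuously.
\<close>

definition globally_asymptotically_stable :: "('a::real_normed_vector \<Rightarrow> 'a) \<Rightarrow> 'a \<Rightarrow> bool" where
  "globally_asymptotically_stable f p \<longleftrightarrow>
     equilibrium f p \<and>
     (\<forall>x0. \<exists>x. forward_solution f x \<and> x 0 = x0) \<and>
     lyapunov_stable f p \<and>
     globally_attractive f p"

end

theory Submission
  imports Defs
begin

text \<open>
  Clearing the inverse inertias and capacitances, the drift matrix acts on node \<open>i\<close> by the block
  with rows \<open>(- (k\<omega> + kdroop), kV)\<close> and \<open>(k\<omega>, - kV)\<close>, and the nodes interact only through
  \<open>- Vnom L\<close> in the voltage equations. Multiplying the first row by \<open>k\<omega> / kV\<close> makes every
  such block symmetric, with both off-diagonal entries equal to \<open>k\<omega>\<close>, and negative definite: its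
  determinant is \<open>k\<omega> kdroop > 0\<close>. The scaling leaves the voltage equations alone, so that
  the Laplacian stays a positive semidefinite matrix. Therefore
  \<open>W(\<omega>, V) = (\<Sum>i. m\<^sub>i (k\<omega>\<^sub>i / kV\<^sub>i) \<omega>\<^sub>i\<^sup>2 + Vnom C\<^sub>i V\<^sub>i\<^sup>2)\<close>,
  taken at the deviation from the equilibrium, is a strict quadratic Lyapunov function for all
  positive gains. Completing the square, its rate of change is
  \<open>- 2 (\<Sum>i. (k\<omega>\<^sub>i kdroop\<^sub>i / kV\<^sub>i) \<omega>\<^sub>i\<^sup>2 + (k\<omega>\<^sub>i \<omega>\<^sub>i - kV\<^sub>i V\<^sub>i)\<^sup>2 / kV\<^sub>i) - 2 Vnom (V \<bullet> L V)\<close>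
  (\<open>mtdc_dissipation\<close>, \<open>weighted_laplacian_nonneg\<close>).

  In finite dimension, a quadratic form that decreases strictly along a linear vector field forces
  exponential decay (\<open>exponential_decay_of_quadratic_lyapunov\<close>). This gives both stability and
  attractivity for every forward solution; that solutions exist from every initial state is the
  convergence of the exponential series (\<open>linear_ode_solution\<close>). The full rank of the matrix
  gives exactly one equilibrium.
\<close>

section \<open>Global solutions of linear differential equations\<close>

text \<open>
  The solution is \<open>exp (t T) x0\<close>, written as the power series
  \<open>\<Sum>n. (t ^ n / fact n) *\<^sub>R (T ^^ n) x0\<close>. Its coordinates are everywhere
  convergent real power series, and those may be differentiated term by term.
\<close>

lemma linear_ode_solution:
  fixes T :: "'a::euclidean_space \<Rightarrow> 'a"
  assumes "linear T"
  obtains u where "u 0 = x0" and "\<And>t. (u has_vector_derivative T (u t)) (at t)"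
proof -
  interpret T: bounded_linear T
    using assms by (rule linear_conv_bounded_linear[THEN iffD1])
  have power_bound: "norm ((T ^^ n) x0) \<le> onorm T ^ n * norm x0" for n
  proof (induction n)
    case (Suc n)
    have "norm ((T ^^ Suc n) x0) \<le> onorm T * norm ((T ^^ n) x0)"
      using onorm[OF T.bounded_linear_axioms] by simp
    also have "\<dots> \<le> onorm T * (onorm T ^ n * norm x0)"
      by (intro mult_left_mono Suc.IH onorm_pos_le T.bounded_linear_axioms)
    finally show ?case by (simp add: mult.assoc)
  qed simp
  define a where "a t n = (t ^ n / fact n) *\<^sub>R (T ^^ n) x0" for t :: real and n
  have summable_a: "summable (a t)" for t
  proof (rule summable_comparison_test')
    show "summable (\<lambda>n. norm x0 * (inverse (fact n) * (\<bar>t\<bar> * onorm T) ^ n))"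
      by (intro summable_mult summable_exp)
    show "norm (a t n) \<le> norm x0 * (inverse (fact n) * (\<bar>t\<bar> * onorm T) ^ n)" for n
      using mult_left_mono[OF power_bound, of "\<bar>t\<bar> ^ n / fact n" n]
      by (simp add: a_def power_abs power_mult_distrib field_simps)
  qed
  define u where "u t = (\<Sum>n. a t n)" for t
  have "((\<lambda>t. u t \<bullet> b) has_real_derivative T (u t) \<bullet> b) (at t)" for t b
  proof -
    define c where "c n = ((T ^^ n) x0 \<bullet> b) / fact n" for n
    have inner_a: "a t n \<bullet> b = c n * t ^ n" for t n
      by (simp add: a_def c_def)
    have summable_c: "summable (\<lambda>n. c n * t ^ n)" for t
      using bounded_linear.summable[OF bounded_linear_inner_left summable_a, of t b] by (simp add: inner_a)
    have u_b: "u t \<bullet> b = (\<Sum>n. c n * t ^ n)" for t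
      using bounded_linear.suminf[OF bounded_linear_inner_left summable_a, of t b] by (simp add: u_def inner_a)
    have "T (a t n) \<bullet> b = diffs c n * t ^ n" for n
      by (simp add: a_def c_def diffs_def T.scaleR divide_simps)
    moreover have "summable (\<lambda>n. T (a t n))"
      by (rule T.summable[OF summable_a])
    ultimately have "T (u t) \<bullet> b = (\<Sum>n. diffs c n * t ^ n)"
      using bounded_linear.suminf[OF bounded_linear_inner_left, of "\<lambda>n. T (a t n)" b] T.suminf[OF summable_a, of t]
      by (simp add: u_def)
    then show ?thesis
      using termdiffs_strong_converges_everywhere[OF summable_c, of t] by (simp add: u_b)
  qed
  then have "(u has_vector_derivative T (u t)) (at t)" for t
    unfolding has_vector_derivative_def
    by (subst has_derivative_componentwise_within)
      (auto simp: has_field_derivative_def mult.commute[of _ "T _ \<bullet> _"] intro: has_derivative_eq_rhs)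
  moreover have "u 0 = x0"
  proof -
    have "a 0 = (\<lambda>n. if n = 0 then x0 else 0)"
      by (auto simp: a_def)
    then show ?thesis
      using sums_unique[OF sums_single[of 0 "\<lambda>_. x0"]] by (simp only: u_def)
  qed
  ultimately show ?thesis using that by blast
qed

section \<open>Quadratic Lyapunov functions\<close>

text \<open>
  The constant is the minimum of the form on the unit sphere, which is compact; homogeneity of
  degree two carries the bound to all vectors.
\<close>

lemma quadratic_form_coercive:
  fixes B :: "'a::euclidean_space \<Rightarrow> 'a \<Rightarrow> real"
  assumes "bounded_bilinear B" and pos: "\<And>z. z \<noteq> 0 \<Longrightarrow> B z z > 0"
  obtains c where "c > 0" and "\<And>z. c * (norm z)\<^sup>2 \<le> B z z"
proof -
  interpret B: bounded_bilinear B by fact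
  have "continuous_on (sphere 0 1) (\<lambda>z. B z z)"
    by (intro B.continuous_on continuous_on_id)
  moreover have "sphere (0::'a) 1 \<noteq> {}" by simp
  ultimately obtain s where s: "s \<in> sphere 0 1" "\<And>z. z \<in> sphere 0 1 \<Longrightarrow> B s s \<le> B z z"
    using continuous_attains_inf[of "sphere (0::'a) 1" "\<lambda>z. B z z"] by (metis compact_sphere)
  have "B s s * (norm z)\<^sup>2 \<le> B z z" for z
  proof (cases "z = 0")
    case False
    then have "B s s \<le> B (z /\<^sub>R norm z) (z /\<^sub>R norm z)"
      by (intro s(2)) simp
    then show ?thesis
      using False by (simp add: B.scaleR_left B.scaleR_right field_simps power2_eq_square)
  qed (simp add: B.zero_left)
  moreover have "B s s > 0"
    using s(1) by (intro pos) auto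
  ultimately show ?thesis using that by blast
qed

text \<open>
  The Lyapunov function is \<open>z \<bullet> H z\<close>. If \<open>c |z|\<^sup>2 \<le> z \<bullet> H z \<le> d |z|\<^sup>2\<close> and
  \<open>z \<bullet> H (T z) \<le> - a |z|\<^sup>2\<close>, then along a solution its logarithmic derivative is at most
  \<open>- 2 a / d\<close>, and passing back to the norm costs only the factor \<open>sqrt (d / c)\<close>. These constants
  are the same for all solutions, as Lyapunov stability requires.
\<close>

lemma exponential_decay_of_quadratic_lyapunov:
  fixes T H :: "'a::euclidean_space \<Rightarrow> 'a"
  assumes "linear T" and "linear H"
    and self_adjoint: "\<And>x y. H x \<bullet> y = x \<bullet> H y"
    and pos: "\<And>z. z \<noteq> 0 \<Longrightarrow> z \<bullet> H z > 0"
    and neg: "\<And>z. z \<noteq> 0 \<Longrightarrow> z \<bullet> H (T z) < 0"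
  obtains K r where "K > 0" and "r > 0"
    and "\<And>z t. forward_solution T z \<Longrightarrow> t \<ge> 0 \<Longrightarrow> norm (z t) \<le> K * exp (- r * t) * norm (z 0)"
proof -
  have lin: "bounded_linear T" "bounded_linear H"
    using assms(1,2) by (simp_all add: linear_conv_bounded_linear)
  have bil: "bounded_bilinear (\<lambda>x y. x \<bullet> H y)"
    by (rule bounded_bilinear.comp[OF bounded_bilinear_inner bounded_linear_ident lin(2)])
  have "bounded_bilinear (\<lambda>x y. - x \<bullet> H (T y))"
    by (rule bounded_bilinear.comp[OF bounded_bilinear_inner])
      (auto intro: bounded_linear_minus bounded_linear_ident bounded_linear_compose lin)
  then obtain a where a: "a > 0" "\<And>z. a * (norm z)\<^sup>2 \<le> - z \<bullet> H (T z)"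
    using neg by (elim quadratic_form_coercive) auto
  obtain c where c: "c > 0" "\<And>z. c * (norm z)\<^sup>2 \<le> z \<bullet> H z"
    using quadratic_form_coercive[OF bil pos] by blast
  obtain d where d: "d > 0" "\<And>z. norm (z \<bullet> H z) \<le> norm z * norm z * d"
    using bounded_bilinear.pos_bounded[OF bil] by blast
  define r where "r = a / d"
  have rate: "z \<bullet> H (T z) \<le> - r * (z \<bullet> H z)" for z
  proof -
    have "r * (z \<bullet> H z) \<le> r * ((norm z)\<^sup>2 * d)"
      using d(2)[of z] a(1) d(1)
      by (intro mult_left_mono) (auto simp: r_def power2_eq_square)
    also have "\<dots> \<le> - z \<bullet> H (T z)"
      using a(2)[of z] d(1) by (simp add: r_def)
    finally show ?thesis by simp
  qed
  have decay: "z t \<bullet> H (z t) \<le> exp (- (2 * r) * t) * (z 0 \<bullet> H (z 0))"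
    if z: "forward_solution T z" and "t \<ge> 0" for z t
  proof -
    \<comment> \<open>With the expected decay compensated by the exponential factor, \<open>W\<close> has to be nonincreasing.\<close>
    define W where "W s = exp (2 * r * s) * (z s \<bullet> H (z s))" for s
    define W' where "W' s = 2 * exp (2 * r * s) * (z s \<bullet> H (T (z s)) + r * (z s \<bullet> H (z s)))" for s
    have W: "(W has_real_derivative W' s) (at s within {0..})" if "s \<ge> 0" for s
    proof -
      have deriv_z: "(z has_vector_derivative T (z s)) (at s within {0..})"
        using z that by (simp add: forward_solution_def)
      have "((\<lambda>s. z s \<bullet> H (z s)) has_real_derivative 2 * (z s \<bullet> H (T (z s)))) (at s within {0..})"
        unfolding has_real_derivative_iff_has_vector_derivative
        using bounded_bilinear.has_vector_derivative[OF bil deriv_z deriv_z] self_adjoint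
        by (simp add: inner_commute)
      then show ?thesis
        unfolding W_def W'_def
        by (auto intro!: derivative_eq_intros simp: algebra_simps)
    qed
    have "W t \<le> W 0"
    proof (rule DERIV_nonpos_imp_decreasing_open[OF \<open>t \<ge> 0\<close>])
      \<comment> \<open>A forward solution has a two-sided derivative only at positive times; at time \<open>0\<close> continuity has to do.\<close>
      fix s :: real assume "0 < s" "s < t"
      then have "(W has_real_derivative W' s) (at s)"
        using W[of s] at_within_interior[of s "{0..}"] by simp
      moreover have "W' s \<le> 0"
        using rate[of "z s"] by (simp add: W'_def mult_le_0_iff)
      ultimately show "\<exists>y. DERIV W s :> y \<and> y \<le> 0" by blast
    next
      show "continuous_on {0..t} W"
        by (rule DERIV_continuous_on[where D = W'])
          (auto intro: DERIV_subset[OF W])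
    qed
    then have "exp (- (2 * r) * t) * W t \<le> exp (- (2 * r) * t) * (z 0 \<bullet> H (z 0))"
      by (simp add: W_def)
    then show ?thesis
      by (simp add: W_def mult.assoc[symmetric] exp_add[symmetric])
  qed
  define K where "K = sqrt (d / c)"
  have "norm (z t) \<le> K * exp (- r * t) * norm (z 0)"
    if "forward_solution T z" and "t \<ge> 0" for z t
  proof (rule power2_le_imp_le)
    have "c * (norm (z t))\<^sup>2 \<le> exp (- (2 * r) * t) * (z 0 \<bullet> H (z 0))"
      using c(2)[of "z t"] decay[OF that] by linarith
    also have "\<dots> \<le> exp (- (2 * r) * t) * (d * (norm (z 0))\<^sup>2)"
      using d(2)[of "z 0"] by (simp add: power2_eq_square mult.commute)
    finally have "(norm (z t))\<^sup>2 \<le> d / c * exp (- (2 * r) * t) * (norm (z 0))\<^sup>2"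
      using c(1) by (simp add: field_simps)
    also have "\<dots> = (K * exp (- r * t) * norm (z 0))\<^sup>2"
      using c(1) d(1) by (simp add: K_def power_mult_distrib exp_double[symmetric])
    finally show "(norm (z t))\<^sup>2 \<le> (K * exp (- r * t) * norm (z 0))\<^sup>2" .
    show "0 \<le> K * exp (- r * t) * norm (z 0)"
      using c(1) d(1) by (simp add: K_def)
  qed
  moreover have "K > 0" "r > 0"
    using a(1) c(1) d(1) by (simp_all add: K_def r_def)
  ultimately show ?thesis using that by blast
qed

text \<open>
  Subtracting the equilibrium turns the affine system into the linear one, so that the
  exponential estimate applies to the deviation from the equilibrium.
\<close>

theorem affine_globally_asymptotically_stable:
  fixes T H :: "'a::euclidean_space \<Rightarrow> 'a"
  assumes "linear T" and "linear H"
    and "\<And>x y. H x \<bullet> y = x \<bullet> H y"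
    and "\<And>z. z \<noteq> 0 \<Longrightarrow> z \<bullet> H z > 0"
    and "\<And>z. z \<noteq> 0 \<Longrightarrow> z \<bullet> H (T z) < 0"
    and f: "f = (\<lambda>x. T x + b)" and p: "equilibrium f p"
  shows "globally_asymptotically_stable f p"
proof -
  have f_shift: "f x = T (x - p)" for x
    using p by (simp add: f equilibrium_def linear_diff[OF \<open>linear T\<close>] eq_neg_iff_add_eq_0[symmetric])
  obtain K r where K: "K > 0" and r: "r > 0"
    and decay: "\<And>z t. forward_solution T z \<Longrightarrow> t \<ge> 0 \<Longrightarrow> norm (z t) \<le> K * exp (- r * t) * norm (z 0)"
    using exponential_decay_of_quadratic_lyapunov[OF assms(1-5)] by blast
  have bound: "norm (x t - p) \<le> K * exp (- r * t) * norm (x 0 - p)"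
    if "forward_solution f x" and "t \<ge> 0" for x t
  proof (rule decay[OF _ \<open>t \<ge> 0\<close>])
    show "forward_solution T (\<lambda>t. x t - p)"
      using that(1) by (auto simp: forward_solution_def f_shift intro!: derivative_eq_intros)
  qed
  show ?thesis
    unfolding globally_asymptotically_stable_def
  proof (intro conjI allI p)
    fix x0
    obtain u where u: "u 0 = x0 - p" "\<And>t. (u has_vector_derivative T (u t)) (at t)"
      using linear_ode_solution[OF \<open>linear T\<close>] by blast
    have "((\<lambda>t. u t + p) has_vector_derivative T (u t)) (at t within {0..})" for t
      using has_vector_derivative_add_const u(2) by (blast intro: has_vector_derivative_at_within)
    then have "forward_solution f (\<lambda>t. u t + p)"
      by (simp add: forward_solution_def f_shift)
    moreover have "u 0 + p = x0"
      using u(1) by simp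
    ultimately show "\<exists>x. forward_solution f x \<and> x 0 = x0" by blast
  next
    show "lyapunov_stable f p"
      unfolding lyapunov_stable_def
    proof (intro allI impI)
      fix \<epsilon> :: real assume "\<epsilon> > 0"
      have "norm (x t - p) < \<epsilon>"
        if "forward_solution f x" "norm (x 0 - p) < \<epsilon> / K" "t \<ge> 0" for x t
      proof -
        have "norm (x t - p) \<le> K * exp (- r * t) * norm (x 0 - p)"
          using bound that by blast
        also have "\<dots> \<le> K * 1 * norm (x 0 - p)"
          using K r that(3) by (intro mult_right_mono mult_left_mono) auto
        also have "\<dots> < \<epsilon>"
          using K that(2) by (simp add: field_simps)
        finally show ?thesis .
      qed
      then show "\<exists>\<delta>>0. \<forall>x. forward_solution f x \<and> norm (x 0 - p) < \<delta> \<longrightarrow>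
          (\<forall>t\<ge>0. norm (x t - p) < \<epsilon>)"
        using K \<open>\<epsilon> > 0\<close> by (intro exI[of _ "\<epsilon> / K"]) auto
    qed
  next
    show "globally_attractive f p"
      unfolding globally_attractive_def
    proof (intro allI impI)
      fix x assume x: "forward_solution f x"
      have "((\<lambda>t. exp (- r * t)) \<longlongrightarrow> 0) at_top"
        using r
        by (intro filterlim_compose[OF exp_at_bot] filterlim_tendsto_neg_mult_at_bot[OF tendsto_const]
            filterlim_ident) auto
      then have "((\<lambda>t. K * exp (- r * t) * norm (x 0 - p)) \<longlongrightarrow> 0) at_top"
        by (intro tendsto_mult_left_zero tendsto_mult_right_zero)
      moreover have "\<forall>\<^sub>F t in at_top. norm (x t - p) \<le> K * exp (- r * t) * norm (x 0 - p)"
        using eventually_ge_at_top[of 0] by eventually_elim (rule bound[OF x])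
      ultimately have "((\<lambda>t. x t - p) \<longlongrightarrow> 0) at_top"
        by (rule Lim_null_comparison[rotated])
      then show "(x \<longlongrightarrow> p) at_top" by (rule LIM_zero_cancel)
    qed
  qed
qed

lemma affine_ex1_equilibrium:
  fixes T :: "'a::euclidean_space \<Rightarrow> 'a"
  assumes "linear T" and "inj T"
  shows "\<exists>!p. equilibrium (\<lambda>x. T x + b) p"
proof -
  have "bij T"
    using assms by (simp add: bij_def linear_injective_imp_surjective)
  then have "\<exists>!p. T p = - b" by (simp add: bij_iff)
  then show ?thesis by (simp add: equilibrium_def eq_neg_iff_add_eq_0)
qed

section \<open>Diagonal matrices, block matrices and graph Laplacians\<close>

lemma diag_matrix_mult_nth: "(diag_matrix d *v x) $ i = d $ i * x $ i"
  by (simp add: diag_matrix_def matrix_vector_mult_def if_distrib[of "\<lambda>a. a * _"] cong: if_cong)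

lemma diag_matrix_quadratic_form: "x \<bullet> (diag_matrix d *v y) = (\<Sum>i\<in>UNIV. d $ i * x $ i * y $ i)"
  by (simp add: inner_vec_def diag_matrix_mult_nth mult_ac)

lemma block_matrix_mult_nth:
  fixes P :: "real^'m^'m" and T :: "real^'n^'n"
  shows "(block_matrix P Q S T *v z) $ Inl k = (P *v (\<chi> l. z $ Inl l)) $ k + (Q *v (\<chi> l. z $ Inr l)) $ k"
    and "(block_matrix P Q S T *v z) $ Inr k' = (S *v (\<chi> l. z $ Inl l)) $ k' + (T *v (\<chi> l. z $ Inr l)) $ k'"
  by (simp_all add: block_matrix_def matrix_vector_mult_def UNIV_Plus_UNIV[symmetric] sum.Plus
      del: UNIV_Plus_UNIV)

text \<open>
  With \<open>B\<close> the incidence matrix, \<open>v \<bullet> L v\<close> is the weighted sum of the squares of the entries of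
  \<open>transpose B *v v\<close>. At an edge between distinct vertices the entry is the difference of \<open>v\<close>:
  for voltages and conductances, the ohmic losses in the lines.
\<close>

lemma weighted_laplacian_nonneg:
  assumes w: "\<And>i j. (i, j) \<in> D \<Longrightarrow> w i j \<ge> 0"
  shows "v \<bullet> (weighted_laplacian D w *v v) \<ge> 0"
proof -
  define B where "B = incidence_matrix D"
  define y where "y = transpose B *v v"
  \<comment> \<open>Pairs that are not oriented edges may carry a negative weight, but their columns vanish.\<close>
  have y0: "y $ e = 0" if "e \<notin> D" for e
    using that by (simp add: y_def B_def incidence_matrix_def transpose_def matrix_vector_mult_def)
  have "v \<bullet> (weighted_laplacian D w *v v) = y \<bullet> (diag_matrix (\<chi> e. w (fst e) (snd e)) *v y)"
    unfolding weighted_laplacian_def B_def[symmetric] y_def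
    by (simp add: matrix_vector_mul_assoc[symmetric] dot_lmul_matrix[symmetric]
        flip: transpose_matrix_vector del: transpose_matrix_vector)
  also have "\<dots> = (\<Sum>e\<in>UNIV. w (fst e) (snd e) * (y $ e)\<^sup>2)"
    by (simp add: diag_matrix_quadratic_form power2_eq_square mult.assoc)
  also have "\<dots> \<ge> 0"
  proof (rule sum_nonneg)
    fix e show "0 \<le> w (fst e) (snd e) * (y $ e)\<^sup>2"
      using w[of "fst e" "snd e"] y0[of e] by (cases "e \<in> D") auto
  qed
  finally show ?thesis .
qed

section \<open>The Lyapunov function of the MTDC system\<close>

lemma minus_matrix_vector_mult:
  fixes B :: "'a::ring_1^'n^'m"
  shows "(- B) *v x = - (B *v x)"
  by (simp add: matrix_vector_mult_def vec_eq_iff sum_negf)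

lemma mtdc_matrix_mult_nth:
  fixes z :: "real^('n::finite + 'n)"
  assumes A_def: "A = mtdc_matrix m C k\<omega> kdroop kV Vnom L"
  shows "(A *v z) $ Inl k = (kV $ k * z $ Inr k - (k\<omega> $ k + kdroop $ k) * z $ Inl k) / m $ k"
    and "(A *v z) $ Inr k = ((k\<omega> $ k * z $ Inl k - kV $ k * z $ Inr k) / Vnom
            - (L *v (\<chi> l. z $ Inr l)) $ k) / C $ k"
  by (simp_all only: A_def mtdc_matrix_def Let_def block_matrix_mult_nth minus_matrix_vector_mult
      matrix_vector_mul_assoc[symmetric] matrix_vector_mult_add_rdistrib
      scaleR_matrix_vector_assoc[symmetric] diag_matrix_mult_nth vector_add_component
      vector_uminus_component vector_scaleR_component vec_lambda_beta)
    (simp_all add: divide_inverse algebra_simps)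

text \<open>
  The frequency weight \<open>m k\<omega> / kV\<close> is the one that makes the coupling between frequency and
  voltage at a node symmetric once the voltage weight has been fixed to be \<open>Vnom C\<close>. The latter is
  a constant multiple of the capacitance, so that the factor in front of the Laplacian does
  not depend on the node.
\<close>

definition mtdc_storage_weights ::
    "real^'n \<Rightarrow> real^'n \<Rightarrow> real^'n \<Rightarrow> real^'n \<Rightarrow> real \<Rightarrow> real^('n + 'n)" where
  "mtdc_storage_weights m C k\<omega> kV Vnom =
    block_vector (\<chi> i. m $ i * k\<omega> $ i / kV $ i) (\<chi> i. Vnom * C $ i)"

text \<open>
  This is half the rate of change of the Lyapunov function. The cross terms \<open>2 k\<omega> w v\<close> of the
  symmetrised node blocks are absorbed by completing the square; what remains of the frequency
  term is due to the droop gain.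
\<close>

lemma mtdc_dissipation:
  fixes m C k\<omega> kdroop kV :: "real^'n" and z :: "real^('n + 'n)"
  assumes "\<And>i. m $ i \<noteq> 0" and "\<And>i. C $ i \<noteq> 0" and "\<And>i. kV $ i \<noteq> 0" and "Vnom \<noteq> 0"
  defines "w \<equiv> \<chi> i. z $ Inl i" and "v \<equiv> \<chi> i. z $ Inr i"
  shows "z \<bullet> (diag_matrix (mtdc_storage_weights m C k\<omega> kV Vnom) *v
            (mtdc_matrix m C k\<omega> kdroop kV Vnom L *v z)) =
    - (\<Sum>i\<in>UNIV. k\<omega> $ i * kdroop $ i / kV $ i * (w $ i)\<^sup>2)
    - (\<Sum>i\<in>UNIV. (k\<omega> $ i * w $ i - kV $ i * v $ i)\<^sup>2 / kV $ i)
    - Vnom * (v \<bullet> (L *v v))"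
proof -
  define d where "d = mtdc_storage_weights m C k\<omega> kV Vnom"
  define y where "y = mtdc_matrix m C k\<omega> kdroop kV Vnom L *v z"
  have summand: "d $ Inl i * z $ Inl i * y $ Inl i + d $ Inr i * z $ Inr i * y $ Inr i =
      - (k\<omega> $ i * kdroop $ i / kV $ i * (w $ i)\<^sup>2)
      - (k\<omega> $ i * w $ i - kV $ i * v $ i)\<^sup>2 / kV $ i
      - Vnom * (v $ i * (L *v v) $ i)" for i
    using assms(1-4)
    by (simp add: d_def y_def w_def v_def mtdc_storage_weights_def block_vector_def
        mtdc_matrix_mult_nth field_simps power2_eq_square)
  have "z \<bullet> (diag_matrix d *v y) =
      (\<Sum>i\<in>UNIV. d $ Inl i * z $ Inl i * y $ Inl i + d $ Inr i * z $ Inr i * y $ Inr i)"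
    by (simp add: diag_matrix_quadratic_form UNIV_Plus_UNIV[symmetric] sum.Plus sum.distrib
        del: UNIV_Plus_UNIV)
  also have "\<dots> = - (\<Sum>i\<in>UNIV. k\<omega> $ i * kdroop $ i / kV $ i * (w $ i)\<^sup>2)
      - (\<Sum>i\<in>UNIV. (k\<omega> $ i * w $ i - kV $ i * v $ i)\<^sup>2 / kV $ i)
      - Vnom * (v \<bullet> (L *v v))"
    by (simp add: summand sum_subtractf sum_negf sum_distrib_left inner_vec_def)
  finally show ?thesis by (simp add: d_def y_def)
qed

text \<open>
  Vanishing dissipation forces zero frequencies through the droop term, and then zero
  voltages through the squares.
\<close>

lemma mtdc_dissipation_neg:
  fixes m C k\<omega> kdroop kV :: "real^'n" and z :: "real^('n + 'n)"
  assumes pos: "\<And>i. m $ i > 0" "\<And>i. C $ i > 0" "\<And>i. k\<omega> $ i > 0" "\<And>i. kdroop $ i > 0"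
      "\<And>i. kV $ i > 0" "Vnom > 0"
    and L: "\<And>v. v \<bullet> (L *v v) \<ge> 0"
    and "z \<noteq> 0"
  shows "z \<bullet> (diag_matrix (mtdc_storage_weights m C k\<omega> kV Vnom) *v
            (mtdc_matrix m C k\<omega> kdroop kV Vnom L *v z)) < 0"
proof -
  define w where "w = (\<chi> i. z $ Inl i)"
  define v where "v = (\<chi> i. z $ Inr i)"
  define S where "S = (\<Sum>i\<in>UNIV. k\<omega> $ i * kdroop $ i / kV $ i * (w $ i)\<^sup>2)"
  define U where "U = (\<Sum>i\<in>UNIV. (k\<omega> $ i * w $ i - kV $ i * v $ i)\<^sup>2 / kV $ i)"
  have S_summand: "0 \<le> k\<omega> $ i * kdroop $ i / kV $ i * (w $ i)\<^sup>2" for i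
    using pos(3-5)[of i] by simp
  have U_summand: "0 \<le> (k\<omega> $ i * w $ i - kV $ i * v $ i)\<^sup>2 / kV $ i" for i
    using pos(5)[of i] by simp
  have nonneg: "S \<ge> 0" "U \<ge> 0"
    unfolding S_def U_def by (intro sum_nonneg S_summand U_summand)+
  have "S + U \<noteq> 0"
  proof
    assume "S + U = 0"
    with nonneg have "S = 0" "U = 0" by linarith+
    then have S0: "k\<omega> $ i * kdroop $ i / kV $ i * (w $ i)\<^sup>2 = 0"
      and U0: "(k\<omega> $ i * w $ i - kV $ i * v $ i)\<^sup>2 / kV $ i = 0" for i
      using S_summand U_summand by (simp_all add: S_def U_def sum_nonneg_eq_0_iff)
    have w0: "w $ i = 0" for i
      using S0[of i] pos(3-5)[of i] by simp
    have v0: "v $ i = 0" for i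
      using U0[of i] w0[of i] pos(5)[of i] by simp
    have "z $ i = 0" for i
      using w0 v0 by (cases i) (simp_all add: w_def v_def)
    with \<open>z \<noteq> 0\<close> show False by (simp add: vec_eq_iff)
  qed
  moreover have "Vnom * (v \<bullet> (L *v v)) \<ge> 0"
    using pos(6) L by simp
  moreover have "z \<bullet> (diag_matrix (mtdc_storage_weights m C k\<omega> kV Vnom) *v
      (mtdc_matrix m C k\<omega> kdroop kV Vnom L *v z)) = - S - U - Vnom * (v \<bullet> (L *v v))"
    unfolding S_def U_def w_def v_def
    using pos by (intro mtdc_dissipation) (auto simp: less_imp_neq[symmetric])
  ultimately show ?thesis using nonneg by linarith
qed

theorem theorem1:
  fixes m C k\<omega> kdroop kV Pm :: "real^'n"
    and Vnom :: real
    and G D :: "('n \<times> 'n) set"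
    and R :: "'n \<Rightarrow> 'n \<Rightarrow> real"
    and L :: "real^'n^'n"
    and A :: "real^('n + 'n)^('n + 'n)"
    and f :: "real^('n + 'n) \<Rightarrow> real^('n + 'n)"
  assumes "\<And>i. m $ i > 0" and "\<And>i. C $ i > 0"
    and "\<And>i. k\<omega> $ i > 0" and "\<And>i. kdroop $ i > 0" and "\<And>i. kV $ i > 0"
    and "Vnom > 0"
    and "connected_graph G" and "orientation_of D G"
    and "\<And>i j. (i, j) \<in> G \<Longrightarrow> R i j = R j i \<and> R i j > 0"
    and "L = weighted_laplacian D (\<lambda>i j. 1 / R i j)"
    and "A = mtdc_matrix m C k\<omega> kdroop kV Vnom L"
    and "rank A = CARD('n + 'n)"
    and "f = (\<lambda>x. A *v x + mtdc_input m Pm)"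
  shows "(\<exists>!p. equilibrium f p) \<and>
         (\<forall>p. equilibrium f p \<longrightarrow> globally_asymptotically_stable f p)"
proof -
  define H where "H = (*v) (diag_matrix (mtdc_storage_weights m C k\<omega> kV Vnom))"
  have weights_pos: "mtdc_storage_weights m C k\<omega> kV Vnom $ i > 0" for i
    using assms(1-6) by (cases i) (simp_all add: mtdc_storage_weights_def block_vector_def)
  have "linear ((*v) A)" "linear H"
    by (simp_all add: H_def)
  have H_self_adjoint: "H x \<bullet> y = x \<bullet> H y" for x y
    by (simp add: H_def diag_matrix_quadratic_form inner_commute[of _ y] mult_ac)
  have H_pos: "z \<bullet> H z > 0" if "z \<noteq> 0" for z
  proof -
    from that obtain i where "z $ i \<noteq> 0" by (auto simp: vec_eq_iff)
    then show ?thesis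
      unfolding H_def diag_matrix_quadratic_form
      using weights_pos by (intro sum_pos2[of _ i]) (auto simp: mult.assoc zero_less_mult_iff less_imp_le
          not_less linorder_neq_iff)
  qed
  have "D \<subseteq> G"
    using assms(8) by (auto simp: orientation_of_def)
  then have "v \<bullet> (L *v v) \<ge> 0" for v
    unfolding assms(10) using assms(9)
    by (intro weighted_laplacian_nonneg) (auto simp: less_imp_le)
  then have H_A_neg: "z \<bullet> H (A *v z) < 0" if "z \<noteq> 0" for z
    unfolding H_def assms(11) using assms(1-6) that by (intro mtdc_dissipation_neg) auto
  have "inj ((*v) A)"
    using assms(12) full_rank_injective by blast
  then have "\<exists>!p. equilibrium f p"
    unfolding assms(13) by (intro affine_ex1_equilibrium \<open>linear ((*v) A)\<close>)
  moreover have "globally_asymptotically_stable f p" if "equilibrium f p" for p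
    by (rule affine_globally_asymptotically_stable[OF \<open>linear ((*v) A)\<close> \<open>linear H\<close>
          H_self_adjoint H_pos H_A_neg assms(13) that])
  ultimately show ?thesis by blast
qed

end
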